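(* Let $G$ be a countably infinite group and let $G\curvearrowright X$ be an expansive action on a compact metrizable space by homeomorphisms with the topological Markov property. Let $k\ge1$ be an integer and $(x_1,\dots,x_k,x_{k+1})\in X^{k+1}$ such that $(x_1,\dots,x_k)\in\mathrm{IE}_k(X,G)$ and $(x_k,x_{k+1})$ is an asymptotic pair. Then $(x_1,\dots,x_k,x_{k+1})\in\mathrm{IE}_{k+1}(X,G)$.
   Context: Fix a compatible metric $d$ on $X$ (the notions below do not depend on its choice). For $K\subset G$ and $x,y\in X$ write $d_K(x,y)=\sup_{g\in K}d(gx,gy)$. Expansive: there is $c>0$ such that for all $x\neq y$ in $X$ there is $g\in G$ with $d(gx,gy)>c$. Asymptotic pair: $(x,y)\in X^2$ such that for every $\varepsilon>0$ there is a finite $F\subset G$ with $d(gx,gy)\le\varepsilon$ for all $g\notin F$. Memory set: for $\varepsilon,\delta>0$ and finite $A\subset B\subset G$, $B$ is an $(\varepsilon,\delta)$-memory set for $A$ if for every $x,y\in X$ with $d_{B\setminus A}(x,y)\le\delta$ there is $z\in X$ with $d_B(x,z)\le\varepsilon$ and $d_{G\setminus A}(y,z)\le\varepsilon$. Topological Markov property (TMP): for every $\varepsilon>0$ there is $\delta>0$ such that every finite $A\subset G$ admits an $(\varepsilon,\delta)$-memory set. Independence: for a tuple $\mathbf A=(A_1,\dots,A_k)$ of subsets of $X$, $J\subset G$ is an independence set for $\mathbf A$ if for every nonempty finite $I\subset J$ and every $\phi:I\to\{1,\dots,k\}$ we have $\bigcap_{s\in I}s^{-1}A_{\phi(s)}\neq\varnothing$.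 The independence density of $\mathbf A$ is the largest $q\ge0$ such that every finite $F\subset G$ has a subset of cardinality at least $q|F|$ which is an independence set for $\mathbf A$. $\mathrm{IE}_k(X,G)$ is the set of $(x_1,\dots,x_k)\in X^k$ such that for every product neighborhood $U_1\times\dots\times U_k$ of $(x_1,\dots,x_k)$ the tuple $(U_1,\dots,U_k)$ has positive independence density. *)

theory Defs
  imports "HOL-Analysis.Analysis" "HOL-Algebra.Group_Action"
begin

text \<open>Throughout, an action of \<open>G\<close> on a subset \<open>X\<close> of a metric space is a homomorphism
  \<open>act\<close> into the group of bijections of \<open>X\<close> (locale \<^locale>\<open>group_action\<close>); the fixed compatible
  metric on \<open>X\<close> is the restriction of \<^const>\<open>dist\<close>.\<close>

text \<open>The supremum over the empty set of indices is \<open>0\<close>; this occurs for \<open>B - A\<close> in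
  \<open>memory_set\<close> when \<open>B = A\<close>.\<close>

definition dist_on :: "('g \<Rightarrow> 'x \<Rightarrow> 'x::metric_space) \<Rightarrow> 'g set \<Rightarrow> 'x \<Rightarrow> 'x \<Rightarrow> real" where
  "dist_on act K x y = (if K = {} then 0 else (SUP g\<in>K. dist (act g x) (act g y)))"

definition expansive ::
    "('g, 'm) monoid_scheme \<Rightarrow> 'x::metric_space set \<Rightarrow> ('g \<Rightarrow> 'x \<Rightarrow> 'x) \<Rightarrow> bool" where
  "expansive G X act \<longleftrightarrow>
     (\<exists>c>0. \<forall>x\<in>X. \<forall>y\<in>X. x \<noteq> y \<longrightarrow> (\<exists>g\<in>carrier G. dist (act g x) (act g y) > c))"

definition asymptotic_pair ::
    "('g, 'm) monoid_scheme \<Rightarrow> 'x::metric_space set \<Rightarrow> ('g \<Rightarrow> 'x \<Rightarrow> 'x) \<Rightarrow> 'x \<Rightarrow> 'x \<Rightarrow> bool" where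
  "asymptotic_pair G X act x y \<longleftrightarrow>
     x \<in> X \<and> y \<in> X \<and>
     (\<forall>\<epsilon>>0. \<exists>F. finite F \<and> F \<subseteq> carrier G \<and>
        (\<forall>g\<in>carrier G - F. dist (act g x) (act g y) \<le> \<epsilon>))"

definition memory_set ::
    "('g, 'm) monoid_scheme \<Rightarrow> 'x::metric_space set \<Rightarrow> ('g \<Rightarrow> 'x \<Rightarrow> 'x) \<Rightarrow>
     real \<Rightarrow> real \<Rightarrow> 'g set \<Rightarrow> 'g set \<Rightarrow> bool" where
  "memory_set G X act \<epsilon> \<delta> A B \<longleftrightarrow>
     finite B \<and> A \<subseteq> B \<and> B \<subseteq> carrier G \<and>
     (\<forall>x\<in>X. \<forall>y\<in>X. dist_on act (B - A) x y \<le> \<delta> \<longrightarrow>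
        (\<exists>z\<in>X. dist_on act B x z \<le> \<epsilon> \<and> dist_on act (carrier G - A) y z \<le> \<epsilon>))"

definition topological_Markov_property ::
    "('g, 'm) monoid_scheme \<Rightarrow> 'x::metric_space set \<Rightarrow> ('g \<Rightarrow> 'x \<Rightarrow> 'x) \<Rightarrow> bool" where
  "topological_Markov_property G X act \<longleftrightarrow>
     (\<forall>\<epsilon>>0. \<exists>\<delta>>0. \<forall>A. finite A \<and> A \<subseteq> carrier G \<longrightarrow> (\<exists>B. memory_set G X act \<epsilon> \<delta> A B))"

text \<open>A \<open>k\<close>-tuple of subsets of \<open>X\<close> is given by the values of \<open>A\<close> on \<open>{1..k}\<close>.\<close>

definition independence_set ::
    "('g, 'm) monoid_scheme \<Rightarrow> ('g \<Rightarrow> 'x \<Rightarrow> 'x) \<Rightarrow> nat \<Rightarrow> (nat \<Rightarrow> 'x set) \<Rightarrow> 'g set \<Rightarrow> bool" where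
  "independence_set G act k A J \<longleftrightarrow>
     J \<subseteq> carrier G \<and>
     (\<forall>I. finite I \<and> I \<noteq> {} \<and> I \<subseteq> J \<longrightarrow>
        (\<forall>\<phi>\<in>I \<rightarrow> {1..k}. (\<Inter>s\<in>I. act (inv\<^bsub>G\<^esub> s) ` A (\<phi> s)) \<noteq> {}))"

definition independence_density_bound ::
    "('g, 'm) monoid_scheme \<Rightarrow> ('g \<Rightarrow> 'x \<Rightarrow> 'x) \<Rightarrow> nat \<Rightarrow> (nat \<Rightarrow> 'x set) \<Rightarrow> real \<Rightarrow> bool" where
  "independence_density_bound G act k A q \<longleftrightarrow>
     q \<ge> 0 \<and>
     (\<forall>F. finite F \<and> F \<subseteq> carrier G \<longrightarrow>
        (\<exists>J\<subseteq>F. real (card J) \<ge> q * real (card F) \<and> independence_set G act k A J))"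

definition independence_density ::
    "('g, 'm) monoid_scheme \<Rightarrow> ('g \<Rightarrow> 'x \<Rightarrow> 'x) \<Rightarrow> nat \<Rightarrow> (nat \<Rightarrow> 'x set) \<Rightarrow> real" where
  "independence_density G act k A = (GREATEST q. independence_density_bound G act k A q)"

text \<open>The maximum in the definition of the independence density is attained.\<close>

lemma independence_density_greatest:
  assumes "carrier G \<noteq> {}"
  shows "independence_density_bound G act k A (independence_density G act k A)"
    and "independence_density_bound G act k A q \<Longrightarrow> q \<le> independence_density G act k A"
proof -
  let ?P = "independence_density_bound G act k A"
  let ?S = "Collect ?P"
  have P0: "?P 0"
    unfolding independence_density_bound_def independence_set_def by auto
  obtain g where g: "g \<in> carrier G" using assms by blast
  have le1: "q \<le> 1" if q: "?P q" for q
  proof -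
    have "\<exists>J\<subseteq>{g}. real (card J) \<ge> q * real (card {g}) \<and> independence_set G act k A J"
      by (rule q[unfolded independence_density_bound_def, THEN conjunct2, rule_format])
         (simp add: g)
    then obtain J where J: "J \<subseteq> {g}" "real (card J) \<ge> q * real (card {g})"
      by (elim exE conjE)
    have "card J \<le> card {g}" using J(1) by (intro card_mono) auto
    then show ?thesis using J(2) by simp
  qed
  have bdd: "bdd_above ?S" using le1 by (intro bdd_aboveI[of _ 1]) simp
  define s where "s = Sup ?S"
  have s_upper: "q \<le> s" if "?P q" for q
    unfolding s_def using that bdd by (simp add: cSup_upper)
  have "?P s"
    unfolding independence_density_bound_def
  proof (intro conjI allI impI)
    show "0 \<le> s" using s_upper[OF P0] .
  next
    fix F assume F: "finite F \<and> F \<subseteq> carrier G"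
    let ?T = "{J. J \<subseteq> F \<and> independence_set G act k A J}"
    have fin: "finite ?T" using F by simp
    have "{} \<in> ?T" by (simp add: independence_set_def)
    then have ne: "card ` ?T \<noteq> {}" by blast
    define m where "m = Max (card ` ?T)"
    have "m \<in> card ` ?T"
      unfolding m_def by (rule Max_in[OF finite_imageI[OF fin] ne])
    then obtain J where J: "J \<in> ?T" and m: "m = card J" by (rule imageE)
    have max: "card J' \<le> card J" if "J' \<in> ?T" for J'
      unfolding m[symmetric] unfolding m_def
      by (rule Max_ge[OF finite_imageI[OF fin] imageI[OF that]])
    have "s * real (card F) \<le> real (card J)"
    proof (cases "card F = 0")
      case False
      have "q \<le> real (card J) / real (card F)" if "?P q" for q
      proof -
        have "\<exists>J'\<subseteq>F. real (card J') \<ge> q * real (card F) \<and> independence_set G act k A J'"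
          by (rule that[unfolded independence_density_bound_def, THEN conjunct2, rule_format, OF F])
        then obtain J' where J': "J' \<subseteq> F" "real (card J') \<ge> q * real (card F)"
            "independence_set G act k A J'"
          by (elim exE conjE)
        have "card J' \<le> card J" using J' by (intro max CollectI conjI)
        then have "q * real (card F) \<le> real (card J)"
          using J'(2) by linarith
        then show ?thesis using False by (simp add: pos_le_divide_eq)
      qed
      then have "s \<le> real (card J) / real (card F)"
        unfolding s_def using P0 by (intro cSup_least) auto
      then show ?thesis using False by (simp add: pos_le_divide_eq)
    qed simp
    then show "\<exists>J\<subseteq>F. s * real (card F) \<le> real (card J) \<and> independence_set G act k A J"
      using J by blast
  qed
  then have eq: "independence_density G act k A = s"
    unfolding independence_density_def using s_upper by (intro Greatest_equality) auto
  show "?P (independence_density G act k A)"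
    using \<open>?P s\<close> by (simp add: eq)
  show "?P q \<Longrightarrow> q \<le> independence_density G act k A"
    using s_upper by (simp add: eq)
qed

text \<open>Elements of \<open>X\<^sup>k\<close> are extensional functions on \<open>{1..k}\<close>. Neighborhoods are taken in the
  subspace topology of \<open>X\<close> and need not be open.\<close>

definition IE ::
    "nat \<Rightarrow> ('g, 'm) monoid_scheme \<Rightarrow> 'x::metric_space set \<Rightarrow> ('g \<Rightarrow> 'x \<Rightarrow> 'x) \<Rightarrow> (nat \<Rightarrow> 'x) set" where
  "IE k G X act =
     {x \<in> {1..k} \<rightarrow>\<^sub>E X.
        \<forall>U. (\<forall>i\<in>{1..k}. U i \<subseteq> X \<and> x i \<in> top_of_set X interior_of U i) \<longrightarrow>
            independence_density G act k U > 0}"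

end

theory Submission
  imports Defs
begin

text \<open>Let \<open>y\<close> visit small neighborhoods of \<open>x\<^sub>1, \<dots>, x\<^sub>k\<close> along a set \<open>J\<close> that is sparse
  relative to a memory set \<open>B\<close>. At the times \<open>s \<in> J\<close> where \<open>x\<^sub>k\<close> has to be replaced by \<open>x\<^bsub>k+1\<^esub>\<close>,
  the two points are close outside a finite set \<open>A\<close>, so the Markov property allows the replacement
  inside \<open>A s\<close>. The replacements are made one at a time. Each one costs an error \<open>\<epsilon>\<close> everywhere, but
  errors do not accumulate: by uniform expansiveness, an orbit that stays within the expansiveness
  constant of a reference orbit on a large window is much closer to it in the middle of the window.
  The reference is \<open>x\<^bsub>k+1\<^esub>\<close> near the replaced places and \<open>y\<close> elsewhere. Passing to a sparse subset of
  \<open>J\<close> loses only a constant factor of its cardinality.\<close>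

section \<open>Suprema of distances, neighborhoods and positive density\<close>

text \<open>Compactness bounds the distances, so the real supremum is a genuine one;
  \<open>e \<ge> 0\<close> covers empty \<open>K\<close>, where \<open>dist_on\<close> is 0.\<close>

lemma dist_on_le_iff:
  assumes "compact X" and "\<And>g. g \<in> K \<Longrightarrow> act g x \<in> X" and "\<And>g. g \<in> K \<Longrightarrow> act g y \<in> X"
    and "e \<ge> 0"
  shows "dist_on act K x y \<le> e \<longleftrightarrow> (\<forall>g\<in>K. dist (act g x) (act g y) \<le> e)"
proof (cases "K = {}")
  case False
  have "bdd_above ((\<lambda>g. dist (act g x) (act g y)) ` K)"
    using diameter_bounded_bound[OF compact_imp_bounded[OF assms(1)]] assms(2,3)
    by (intro bdd_aboveI[of _ "diameter X"]) auto
  then show ?thesis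
    using False by (simp add: dist_on_def cSUP_le_iff)
qed (simp add: dist_on_def assms(4))

lemma interior_of_contains_ball:
  fixes X :: "'x::metric_space set"
  assumes "x \<in> top_of_set X interior_of U"
  shows "\<exists>e>0. X \<inter> ball x e \<subseteq> U"
proof -
  obtain T where T: "openin (top_of_set X) T" "x \<in> T" "T \<subseteq> U"
    using assms by (auto simp: interior_of_def)
  then obtain e where "e > 0" "ball x e \<inter> X \<subseteq> T"
    unfolding openin_contains_ball by metis
  then show ?thesis using T(3) by (metis Int_commute subset_trans)
qed

lemma independence_density_pos_iff:
  assumes "carrier G \<noteq> {}"
  shows "independence_density G act k A > 0 \<longleftrightarrow> (\<exists>q>0. independence_density_bound G act k A q)"
  using independence_density_greatest[OF assms, of act k A] by force

section \<open>Actions on a compact set and uniform expansiveness\<close>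

locale compact_group_action = group_action G X act
  for G (structure) and X :: "'x::metric_space set" and act +
  assumes compact_X: "compact X"
    and homeomorphic_act:
      "g \<in> carrier G \<Longrightarrow> homeomorphic_map (top_of_set X) (top_of_set X) (act g)"
begin

sublocale group G
  using group_hom group_hom.axioms(1) by blast

lemma act_closed: "g \<in> carrier G \<Longrightarrow> x \<in> X \<Longrightarrow> act g x \<in> X"
  using element_image by blast

lemma act_mult: "g \<in> carrier G \<Longrightarrow> h \<in> carrier G \<Longrightarrow> x \<in> X \<Longrightarrow> act (g \<otimes> h) x = act g (act h x)"
  using composition_rule by blast

lemma act_one: "x \<in> X \<Longrightarrow> act \<one> x = x"
  using id_eq_one by (metis restrict_apply)

lemma act_act_inv:
  "g \<in> carrier G \<Longrightarrow> x \<in> X \<Longrightarrow> act g (act (inv g) x) = x"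
  by (simp add: act_mult[symmetric] act_one)

lemma act_inv_act:
  "g \<in> carrier G \<Longrightarrow> x \<in> X \<Longrightarrow> act (inv g) (act g x) = x"
  by (simp add: act_mult[symmetric] act_one)

text \<open>Lets the intersections in \<open>independence_set\<close> be read as orbits that visit
  prescribed sets at prescribed times.\<close>

lemma mem_act_inv_image_iff:
  assumes "g \<in> carrier G" "U \<subseteq> X"
  shows "y \<in> act (inv g) ` U \<longleftrightarrow> y \<in> X \<and> act g y \<in> U"
proof
  assume "y \<in> act (inv g) ` U"
  then show "y \<in> X \<and> act g y \<in> U"
    using assms by (auto simp: act_closed act_act_inv subset_iff)
next
  assume "y \<in> X \<and> act g y \<in> U"
  then show "y \<in> act (inv g) ` U"
    using assms act_inv_act by (metis imageI)
qed

lemma continuous_on_act: "g \<in> carrier G \<Longrightarrow> continuous_on X (act g)"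
  using homeomorphic_imp_continuous_map[OF homeomorphic_act]
  by (simp add: continuous_map_in_subtopology)

text \<open>The pairs at distance at least \<eta> form a compact set \<open>K\<close>. The closed
  sets \<open>f g\<close> of pairs in \<open>K\<close> that \<open>g\<close> does not separate
  beyond \<open>c\<close> have no common point, by expansiveness, so finitely many of them already
  have empty intersection; their indices form \<open>W\<close>.\<close>

lemma uniformly_expansive:
  assumes c: "\<forall>x\<in>X. \<forall>y\<in>X. x \<noteq> y \<longrightarrow> (\<exists>g\<in>carrier G. dist (act g x) (act g y) > c)"
    and "\<eta> > 0"
  shows "\<exists>W. finite W \<and> W \<subseteq> carrier G \<and>
    (\<forall>x\<in>X. \<forall>y\<in>X. (\<forall>w\<in>W. dist (act w x) (act w y) \<le> c) \<longrightarrow> dist x y < \<eta>)"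
proof -
  define K where "K = (X \<times> X) \<inter> {p. \<eta> \<le> dist (fst p) (snd p)}"
  define f where "f g = K \<inter> {p. dist (act g (fst p)) (act g (snd p)) \<le> c}" for g
  have "closed {p::'x \<times> 'x. \<eta> \<le> dist (fst p) (snd p)}"
    by (intro closed_Collect_le continuous_intros)
  then have K: "compact K"
    unfolding K_def by (intro compact_Int_closed compact_Times compact_X)
  have "closed (f g)" if "g \<in> carrier G" for g
  proof -
    have "continuous_on K (\<lambda>p. dist (act g (fst p)) (act g (snd p)))"
      by (intro continuous_intros continuous_on_compose2[OF continuous_on_act[OF that]])
         (auto simp: K_def)
    then have "closed (K \<inter> (\<lambda>p. dist (act g (fst p)) (act g (snd p))) -` {..c})"
      by (intro continuous_closed_preimage compact_imp_closed[OF K] closed_atMost)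
    then show ?thesis by (simp add: f_def vimage_def)
  qed
  moreover have "K \<inter> (\<Inter>g\<in>carrier G. f g) = {}"
    using c \<open>\<eta> > 0\<close> by (force simp: f_def K_def)
  ultimately obtain W where W: "finite W" "W \<subseteq> carrier G" "K \<inter> (\<Inter>g\<in>W. f g) = {}"
    using compact_imp_fip_image[OF K, of "carrier G" f] by blast
  have "dist x y < \<eta>" if "x \<in> X" "y \<in> X" "\<forall>w\<in>W. dist (act w x) (act w y) \<le> c" for x y
    using W(3) that by (force simp: f_def K_def)
  then show ?thesis using W(1,2) by blast
qed

section \<open>Replacing orbit segments by the Markov property\<close>

text \<open>Nonnegative errors allow the suprema in \<open>memory_set\<close> to be read pointwise.
  Here \<open>u\<close> is the pattern wanted on \<open>B\<close> and \<open>v\<close> the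
  background kept off \<open>A\<close>.\<close>

lemma memory_set_pointwise:
  assumes "memory_set G X act \<epsilon> \<delta> A B" "\<epsilon> \<ge> 0" "\<delta> \<ge> 0" "u \<in> X" "v \<in> X"
    and "\<And>h. h \<in> B - A \<Longrightarrow> dist (act h u) (act h v) \<le> \<delta>"
  shows "\<exists>z\<in>X. (\<forall>h\<in>B. dist (act h u) (act h z) \<le> \<epsilon>) \<and>
    (\<forall>h\<in>carrier G - A. dist (act h v) (act h z) \<le> \<epsilon>)"
proof -
  have B: "A \<subseteq> B" "B \<subseteq> carrier G" using assms(1) by (auto simp: memory_set_def)
  have iff: "dist_on act K x y \<le> e \<longleftrightarrow> (\<forall>g\<in>K. dist (act g x) (act g y) \<le> e)"
    if "K \<subseteq> carrier G" "x \<in> X" "y \<in> X" "e \<ge> 0" for K x y e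
    using that act_closed by (intro dist_on_le_iff[OF compact_X]) (auto simp: subset_iff)
  have "dist_on act (B - A) u v \<le> \<delta>"
    using assms B by (subst iff) auto
  then obtain z where z: "z \<in> X" "dist_on act B u z \<le> \<epsilon>" "dist_on act (carrier G - A) v z \<le> \<epsilon>"
    using assms(1,4,5) unfolding memory_set_def by blast
  show ?thesis
    using z B assms(2,4,5) by (intro bexI[of _ z]) (auto simp: iff)
qed

text \<open>The two conclusions are proved together by induction on \<open>S\<close>: after a replacement both hold with
  \<open>\<epsilon> + 3 * \<eta>\<close> in place of \<open>3 * \<eta>\<close>, and each is restored with the help of the other one.\<close>

lemma simultaneous_replacement:
  assumes S: "finite S" "S \<subseteq> carrier G"
    and B: "A \<subseteq> B" "B \<subseteq> carrier G"
    and X: "y \<in> X" "p \<in> X" "q \<in> X"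
    and separated: "\<And>s t g h. s \<in> S \<Longrightarrow> t \<in> S \<Longrightarrow> s \<noteq> t \<Longrightarrow> g \<in> B \<Longrightarrow> h \<in> B \<Longrightarrow> g \<otimes> s \<noteq> h \<otimes> t"
    and pq: "\<And>h. h \<in> carrier G - A \<Longrightarrow> dist (act h p) (act h q) \<le> \<eta>"
    and yp: "\<And>s h. s \<in> S \<Longrightarrow> h \<in> B \<Longrightarrow> dist (act (h \<otimes> s) y) (act h p) \<le> \<eta>"
    and W: "W \<subseteq> carrier G" "\<one> \<in> W"
    and contract: "\<And>u v. u \<in> X \<Longrightarrow> v \<in> X \<Longrightarrow> (\<And>w. w \<in> W \<Longrightarrow> dist (act w u) (act w v) \<le> c)
                     \<Longrightarrow> dist u v \<le> \<eta>"
    and window: "\<And>g w w'. g \<in> carrier G \<Longrightarrow> w \<in> W \<Longrightarrow> w' \<in> W \<Longrightarrow> w \<otimes> g \<in> A \<Longrightarrow> w' \<otimes> g \<in> B"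
    and replace: "\<And>u v. u \<in> X \<Longrightarrow> v \<in> X \<Longrightarrow> (\<And>h. h \<in> B - A \<Longrightarrow> dist (act h u) (act h v) \<le> \<delta>)
                   \<Longrightarrow> \<exists>z\<in>X. (\<forall>h\<in>B. dist (act h u) (act h z) \<le> \<epsilon>) \<and>
                          (\<forall>h\<in>carrier G - A. dist (act h v) (act h z) \<le> \<epsilon>)"
    and num: "5 * \<eta> \<le> \<delta>" "\<epsilon> + 3 * \<eta> \<le> c" "\<eta> \<ge> 0"
  shows "\<exists>z\<in>X. (\<forall>g\<in>carrier G. (\<forall>s\<in>S. \<forall>a\<in>A. g \<noteq> a \<otimes> s) \<longrightarrow> dist (act g z) (act g y) \<le> 3 * \<eta>) \<and>
               (\<forall>s\<in>S. \<forall>h\<in>B. dist (act (h \<otimes> s) z) (act h q) \<le> 3 * \<eta>)"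
  using S separated yp
proof (induction S rule: finite_induct)
  case empty
  then show ?case using X num by (intro bexI[of _ y]) auto
next
  case (insert t S)
  have G: "t \<in> carrier G" "S \<subseteq> carrier G" using insert.prems by auto
  have sep: "g \<otimes> s \<noteq> h \<otimes> s'" if "s \<in> insert t S" "s' \<in> insert t S" "s \<noteq> s'" "g \<in> B" "h \<in> B" for g h s s'
    using insert.prems(2)[OF that] .
  have yp: "dist (act (h \<otimes> s) y) (act h p) \<le> \<eta>" if "s \<in> insert t S" "h \<in> B" for s h
    using insert.prems(3)[OF that] .
  obtain v where v: "v \<in> X"
    and v_off: "\<And>g. g \<in> carrier G \<Longrightarrow> (\<And>s a. s \<in> S \<Longrightarrow> a \<in> A \<Longrightarrow> g \<noteq> a \<otimes> s) \<Longrightarrow> dist (act g v) (act g y) \<le> 3 * \<eta>"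
    and v_on: "\<And>s h. s \<in> S \<Longrightarrow> h \<in> B \<Longrightarrow> dist (act (h \<otimes> s) v) (act h q) \<le> 3 * \<eta>"
    using insert.IH[OF G(2) insert.prems(2,3)] by auto
  \<comment> \<open>On the collar \<open>B - A\<close> the orbits of \<open>p\<close> and
    \<open>q\<close> nearly agree, so \<open>y\<close>, which follows \<open>p\<close>, also follows
    \<open>q\<close>. Both the gluing and the recovery of 3\<eta> rest on this.\<close>
  have yq: "dist (act (h \<otimes> s) y) (act h q) \<le> 2 * \<eta>" if "s \<in> insert t S" "h \<in> B" "h \<notin> A" for s h
    using yp[OF that(1,2)] pq[of h] that B dist_triangle[of "act (h \<otimes> s) y" "act h q" "act h p"] by auto
  \<comment> \<open>The pattern \<open>q\<close> is glued into the background
    \<open>act t v\<close>, with time measured relative to \<open>t\<close>. On \<open>B - A\<close>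
    the background is 3\<eta>-close to \<open>y\<close>, since separation keeps these times out of
    the older translates of \<open>A\<close>, and \<open>y\<close> is 2\<eta>-close to
    \<open>q\<close>; hence the requirement 5\<eta> \<le> \<delta>.\<close>
  have "\<exists>z\<in>X. (\<forall>h\<in>B. dist (act h q) (act h z) \<le> \<epsilon>) \<and>
           (\<forall>h\<in>carrier G - A. dist (act h (act t v)) (act h z) \<le> \<epsilon>)"
  proof (rule replace)
    fix h assume h: "h \<in> B - A"
    then have hG: "h \<in> carrier G" using B by auto
    have "dist (act (h \<otimes> t) v) (act (h \<otimes> t) y) \<le> 3 * \<eta>"
      using h hG G B insert.hyps by (intro v_off sep) auto
    then show "dist (act h q) (act h (act t v)) \<le> \<delta>"
      using yq[of t h] h num G v hG
        dist_triangle[of "act (h \<otimes> t) v" "act h q" "act (h \<otimes> t) y"]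
      by (simp add: act_mult dist_commute)
  qed (use X v G act_closed in auto)
  then obtain z0 where z0: "z0 \<in> X"
    and z0_on: "\<And>h. h \<in> B \<Longrightarrow> dist (act h q) (act h z0) \<le> \<epsilon>"
    and z0_off: "\<And>h. h \<in> carrier G - A \<Longrightarrow> dist (act h (act t v)) (act h z0) \<le> \<epsilon>"
    by blast
  \<comment> \<open>Undoing the shift by \<open>t\<close> puts the pattern at the times
    \<open>h \<otimes> t\<close>.\<close>
  define z where "z = act (inv t) z0"
  have z: "z \<in> X" and tz: "act t z = z0"
    using z0 G by (auto simp: z_def act_closed act_act_inv)
  have vz: "dist (act g v) (act g z) \<le> \<epsilon>" if "g \<in> carrier G" "\<And>a. a \<in> A \<Longrightarrow> g \<noteq> a \<otimes> t" for g
  proof -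
    have *: "g \<otimes> inv t \<in> carrier G" "g = g \<otimes> inv t \<otimes> t" using that(1) G by (auto simp: m_assoc)
    then have "g \<otimes> inv t \<notin> A" using that(2) by metis
    then have "dist (act (g \<otimes> inv t) (act t v)) (act (g \<otimes> inv t) (act t z)) \<le> \<epsilon>"
      using z0_off * tz by auto
    then show ?thesis using * G v z by (metis act_mult)
  qed
  \<comment> \<open>The old error 3\<eta> and the new error \<epsilon> add up to at most
    \<open>c\<close>, which is all that \<open>contract\<close> requires.\<close>
  have coarse_off: "dist (act g z) (act g y) \<le> c"
    if "g \<in> carrier G" "\<And>s a. s \<in> insert t S \<Longrightarrow> a \<in> A \<Longrightarrow> g \<noteq> a \<otimes> s" for g
    using vz[of g] v_off[of g] that num dist_triangle[of "act g z" "act g y" "act g v"]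
    by (simp add: dist_commute)
  have coarse_on: "dist (act (h \<otimes> s) z) (act h q) \<le> c" if s: "s \<in> insert t S" and h: "h \<in> B" for s h
  proof (cases "s = t")
    case True
    then have "act (h \<otimes> s) z = act h z0" using h B G z tz by (auto simp: act_mult)
    then show ?thesis using z0_on[OF h] num by (simp add: dist_commute)
  next
    case False
    then have s: "s \<in> S" "s \<in> carrier G" using s G by auto
    have "dist (act (h \<otimes> s) v) (act (h \<otimes> s) z) \<le> \<epsilon>"
      using B h s False insert.hyps by (intro vz sep) auto
    then show ?thesis
      using v_on[OF s(1) h] num dist_triangle[of "act (h \<otimes> s) z" "act h q" "act (h \<otimes> s) v"]
      by (simp add: dist_commute)
  qed
  \<comment> \<open>Where a coarse bound against one reference holds throughout the window
    \<open>W\<close> around a time, \<open>contract\<close> reduces it to \<eta> at that time. The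
    reference is \<open>y\<close> here and \<open>q\<close> in \<open>fine_on\<close>.\<close>
  have fine_off: "dist (act g z) (act g y) \<le> \<eta>"
    if g: "g \<in> carrier G" and *: "\<And>s a w. s \<in> insert t S \<Longrightarrow> a \<in> A \<Longrightarrow> w \<in> W \<Longrightarrow> w \<otimes> g \<noteq> a \<otimes> s" for g
  proof (rule contract)
    fix w assume w: "w \<in> W"
    then have "dist (act (w \<otimes> g) z) (act (w \<otimes> g) y) \<le> c"
      using * g W by (intro coarse_off) auto
    then show "dist (act w (act g z)) (act w (act g y)) \<le> c"
      using w W g z X by (simp add: act_mult subset_iff)
  qed (use g z X act_closed in auto)
  have fine_on: "dist (act (h \<otimes> s) z) (act h q) \<le> \<eta>"
    if s: "s \<in> insert t S" and h: "h \<in> carrier G" and *: "\<And>w. w \<in> W \<Longrightarrow> w \<otimes> h \<in> B" for s h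
  proof (rule contract)
    have sG: "s \<in> carrier G" using s G by auto
    fix w assume w: "w \<in> W"
    then have "dist (act (w \<otimes> h \<otimes> s) z) (act (w \<otimes> h) q) \<le> c"
      using * s by (intro coarse_on) auto
    then show "dist (act w (act (h \<otimes> s) z)) (act w (act h q)) \<le> c"
      using w W h z X sG by (simp add: act_mult act_closed subset_iff)
  qed (use h s G z X act_closed in auto)
  show ?case
  proof (intro bexI[of _ z] conjI ballI impI)
    fix g assume g: "g \<in> carrier G" and off: "\<forall>s\<in>insert t S. \<forall>a\<in>A. g \<noteq> a \<otimes> s"
    show "dist (act g z) (act g y) \<le> 3 * \<eta>"
    proof (cases "\<exists>s\<in>insert t S. \<exists>a\<in>A. \<exists>w\<in>W. w \<otimes> g = a \<otimes> s")
      case False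
      then show ?thesis using fine_off[OF g] num by force
    next
      \<comment> \<open>The window around \<open>g\<close> meets a translate of \<open>A\<close>,
        hence lies in the corresponding translate of \<open>B\<close> by \<open>window\<close>,
        where \<open>q\<close> is the reference. As \<open>h\<close> is in \<open>B - A\<close>,
        passing through \<open>q\<close> costs \<eta> + 2\<eta>.\<close>
      case True
      then obtain s a w where *: "s \<in> insert t S" "a \<in> A" "w \<in> W" "w \<otimes> g = a \<otimes> s" by blast
      define h where "h = g \<otimes> inv s"
      have in_G: "s \<in> carrier G" "a \<in> carrier G" "w \<in> carrier G"
        using * G B W by auto
      then have h: "h \<in> carrier G" "g = h \<otimes> s" using g by (auto simp: h_def m_assoc)
      have "w \<otimes> h = a"
        using * in_G g by (simp add: h_def m_assoc[symmetric]) (simp add: m_assoc)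
      then have WB: "w' \<otimes> h \<in> B" if "w' \<in> W" for w' using window[OF h(1) *(3) that] * by simp
      have "h \<in> B" using WB[OF W(2)] h by simp
      moreover have "h \<notin> A" using off h * by blast
      ultimately show ?thesis
        using fine_on[OF *(1) h(1) WB] yq[OF *(1), of h] h
          dist_triangle3[of "act g z" "act g y" "act h q"]
        by (simp add: dist_commute)
    qed
  next
    fix s h assume s: "s \<in> insert t S" and h: "h \<in> B"
    have in_G: "s \<in> carrier G" "h \<in> carrier G" using s h B G by auto
    show "dist (act (h \<otimes> s) z) (act h q) \<le> 3 * \<eta>"
    proof (cases "\<forall>w\<in>W. w \<otimes> h \<in> B")
      case True
      then show ?thesis using fine_on[OF s in_G(2)] num by force
    next
      \<comment> \<open>The window around \<open>h\<close> leaves \<open>B\<close>, so by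
        \<open>window\<close> it avoids \<open>A\<close>. The reference is now \<open>y\<close>, and
        passing through it again costs \<eta> + 2\<eta>.\<close>
      case False
      then have notA: "w \<otimes> h \<notin> A" if "w \<in> W" for w using window[OF in_G(2) that] by blast
      have "dist (act (h \<otimes> s) z) (act (h \<otimes> s) y) \<le> \<eta>"
      proof (rule fine_off)
        fix s' a w assume *: "s' \<in> insert t S" "a \<in> A" "w \<in> W"
        have G': "s' \<in> carrier G" "a \<in> carrier G" "w \<in> carrier G" using * G B W by auto
        show "w \<otimes> (h \<otimes> s) \<noteq> a \<otimes> s'"
        proof
          assume eq: "w \<otimes> (h \<otimes> s) = a \<otimes> s'"
          \<comment> \<open>\<open>g\<close> is the position of \<open>h \<otimes> s\<close> as seen
            from \<open>s'\<close>. Since \<open>\<one>\<close> is in \<open>W\<close>,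
            \<open>window\<close> places \<open>g\<close> in \<open>B\<close>, and separation of the
            translates of \<open>B\<close> then forces \<open>s = s'\<close>.\<close>
          define g where "g = h \<otimes> s \<otimes> inv s'"
          have g: "g \<in> carrier G" "g \<otimes> s' = h \<otimes> s"
            using G' in_G by (auto simp: g_def m_assoc)
          have "w \<otimes> g = a"
            using eq G' in_G by (simp add: g_def m_assoc[symmetric]) (simp add: m_assoc)
          then have "g \<in> B" using window[OF g(1) *(3) W(2)] * g by simp
          then have "s = s'" using sep[OF *(1) s _ _ h] g by blast
          then have "w \<otimes> h = a" using eq G' in_G by (simp add: m_assoc[symmetric])
          then show False using notA * by blast
        qed
      qed (use in_G in auto)
      moreover have "h \<notin> A" using notA[OF W(2)] in_G by simp
      ultimately show ?thesis
        using yq[OF s h] dist_triangle[of "act (h \<otimes> s) z" "act h q" "act (h \<otimes> s) y"] by simp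
    qed
  qed (rule z)
qed

section \<open>Sparse subsets and neighborhoods defined by finitely many times\<close>

text \<open>A maximal subset \<open>J'\<close> with disjoint translates of \<open>B\<close> works:
  each \<open>t\<close> in \<open>J\<close> satisfies \<open>g \<otimes> s = h \<otimes> t\<close>
  for some \<open>s\<close> in \<open>J'\<close> and \<open>g\<close>, \<open>h\<close> in
  \<open>B\<close>, so it is determined by the triple \<open>(s, g, h)\<close>. If \<open>t\<close>
  is in \<open>J'\<close>, take \<open>s = t\<close> and \<open>g = h\<close>, using that
  \<open>B\<close> is nonempty.\<close>

lemma separated_subset:
  assumes J: "finite J" "J \<subseteq> carrier G" and B: "finite B" "B \<subseteq> carrier G" "B \<noteq> {}"
  shows "\<exists>J'\<subseteq>J. card J \<le> card J' * (card B)\<^sup>2 \<and>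
    (\<forall>s\<in>J'. \<forall>t\<in>J'. s \<noteq> t \<longrightarrow> (\<forall>g\<in>B. \<forall>h\<in>B. g \<otimes> s \<noteq> h \<otimes> t))"
proof -
  define \<S> where "\<S> = {J'. J' \<subseteq> J \<and> (\<forall>s\<in>J'. \<forall>t\<in>J'. s \<noteq> t \<longrightarrow> (\<forall>g\<in>B. \<forall>h\<in>B. g \<otimes> s \<noteq> h \<otimes> t))}"
  have "finite \<S>" "{} \<in> \<S>" using J by (auto simp: \<S>_def)
  then obtain J' where J': "J' \<in> \<S>" and maximal: "\<And>K. K \<in> \<S> \<Longrightarrow> J' \<subseteq> K \<Longrightarrow> J' = K"
    using finite_has_maximal[of \<S>] by blast
  have "J \<subseteq> (\<lambda>(s, g, h). inv h \<otimes> (g \<otimes> s)) ` (J' \<times> B \<times> B)"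
  proof
    fix t assume t: "t \<in> J"
    have "\<exists>s\<in>J'. \<exists>g\<in>B. \<exists>h\<in>B. g \<otimes> s = h \<otimes> t"
    proof (cases "t \<in> J'")
      case False
      then have "insert t J' \<notin> \<S>" using maximal[of "insert t J'"] by auto
      then consider s g h where "s \<in> J'" "g \<in> B" "h \<in> B" "g \<otimes> s = h \<otimes> t \<or> h \<otimes> t = g \<otimes> s"
        using J' t unfolding \<S>_def by blast
      then show ?thesis by cases metis
    qed (use B in blast)
    then obtain s g h where *: "s \<in> J'" "g \<in> B" "h \<in> B" "g \<otimes> s = h \<otimes> t" by blast
    then have "t = inv h \<otimes> (g \<otimes> s)"
      using B J t by (simp add: m_assoc[symmetric] subset_iff)
    then show "t \<in> (\<lambda>(s, g, h). inv h \<otimes> (g \<otimes> s)) ` (J' \<times> B \<times> B)"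
      using * by force
  qed
  moreover have "finite J'" using J' J finite_subset by (auto simp: \<S>_def)
  ultimately have "card J \<le> card (J' \<times> B \<times> B)"
    using B by (intro surj_card_le) auto
  then have "card J \<le> card J' * (card B)\<^sup>2"
    by (simp add: card_cartesian_product power2_eq_square)
  then show ?thesis using J' by (intro exI[of _ J']) (simp add: \<S>_def)
qed

text \<open>Finiteness of \<open>B\<close> keeps the intersection of the preimages of balls open;
  sets of this form are the neighborhoods to which \<open>IE k\<close> is applied.\<close>

lemma neighborhood_in_interior:
  assumes "x \<in> X" "finite B" "B \<subseteq> carrier G" "\<eta> > 0"
  shows "x \<in> top_of_set X interior_of {u \<in> X. \<forall>h\<in>B. dist (act h u) (act h x) < \<eta>}"
proof (rule interior_of_maximal[THEN subsetD])
  have "openin (top_of_set X) {u \<in> X. dist (act h u) (act h x) < \<eta>}" if "h \<in> B" for h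
  proof -
    have "continuous_on X (act h)" using that assms by (intro continuous_on_act) auto
    then have "openin (top_of_set X) (X \<inter> act h -` ball (act h x) \<eta>)"
      by (intro continuous_openin_preimage_gen) auto
    moreover have "X \<inter> act h -` ball (act h x) \<eta> = {u \<in> X. dist (act h u) (act h x) < \<eta>}"
      by (auto simp: dist_commute)
    ultimately show ?thesis by simp
  qed
  then have "openin (top_of_set X) (X \<inter> (\<Inter>h\<in>B. {u \<in> X. dist (act h u) (act h x) < \<eta>}))"
    using assms(2) by (intro openin_Int_Inter) auto
  moreover have "X \<inter> (\<Inter>h\<in>B. {u \<in> X. dist (act h u) (act h x) < \<eta>}) =
      {u \<in> X. \<forall>h\<in>B. dist (act h u) (act h x) < \<eta>}" by auto
  ultimately show "openin (top_of_set X) {u \<in> X. \<forall>h\<in>B. dist (act h u) (act h x) < \<eta>}" by simp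
qed (use assms in auto)

section \<open>From k-tuples to (k+1)-tuples\<close>

text \<open>The order of choices matters: \<eta> depends on \<delta>, \<open>c\<close> and
  \<open>r\<close>; \<open>W\<close> and \<open>A\<close> on \<eta>; \<open>B\<close> on
  \<open>W\<close> and \<open>A\<close>; the neighborhoods \<open>V\<close> on \<open>B\<close> and
  \<eta>. Only then is independence of the first \<open>k\<close> points used, for
  \<open>V\<close>.\<close>

lemma IE_extend_asymptotic:
  assumes "expansive G X act" and "topological_Markov_property G X act"
    and "k \<ge> 1"
    and "x \<in> {1..k+1} \<rightarrow>\<^sub>E X"
    and "restrict x {1..k} \<in> IE k G X act"
    and "asymptotic_pair G X act (x k) (x (k+1))"
  shows "x \<in> IE (k+1) G X act"
proof -
  have ne: "carrier G \<noteq> {}" using one_closed by auto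
  have xX: "x i \<in> X" if "i \<in> {1..k+1}" for i by (rule PiE_mem[OF assms(4) that])
  have "independence_density G act (k+1) U > 0"
    if U: "\<forall>i\<in>{1..k+1}. U i \<subseteq> X \<and> x i \<in> top_of_set X interior_of U i" for U
  proof -
    have "\<exists>e>0. X \<inter> ball (x i) e \<subseteq> U i" if "i \<in> {1..k+1}" for i
      using U that by (intro interior_of_contains_ball) simp
    then obtain e where e: "\<And>i. i \<in> {1..k+1} \<Longrightarrow> e i > 0 \<and> X \<inter> ball (x i) (e i) \<subseteq> U i"
      by metis
    define r where "r = Min (e ` {1..k+1})"
    have r: "r > 0" unfolding r_def using e by (subst Min_gr_iff) auto
    have ball_r: "X \<inter> ball (x i) r \<subseteq> U i" if "i \<in> {1..k+1}" for i
    proof -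
      have "r \<le> e i" unfolding r_def using that by (intro Min_le) auto
      then show ?thesis using e[OF that] by auto
    qed
    obtain c where c: "c > 0" "\<forall>u\<in>X. \<forall>v\<in>X. u \<noteq> v \<longrightarrow> (\<exists>g\<in>carrier G. dist (act g u) (act g v) > c)"
      using assms(1) unfolding expansive_def by blast
    define \<epsilon> where "\<epsilon> = c / 4"
    obtain \<delta> where \<delta>: "\<delta> > 0" and memory: "\<And>A. finite A \<Longrightarrow> A \<subseteq> carrier G \<Longrightarrow> \<exists>B. memory_set G X act \<epsilon> \<delta> A B"
      using assms(2) c unfolding topological_Markov_property_def \<epsilon>_def
      by (metis zero_less_divide_iff zero_less_numeral)
    \<comment> \<open>Chosen so that 5\<eta> respects \<delta>, \<epsilon> + 5\<eta> + 3\<eta> \<le>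
      \<open>c\<close>, and the final distance 3\<eta> + \<eta> stays below
      \<open>r\<close>.\<close>
    define \<eta> where "\<eta> = Min {\<delta>, c / 4, r} / 5"
    have \<eta>: "\<eta> > 0" "5 * \<eta> \<le> \<delta>" "5 * \<eta> \<le> c / 4" "5 * \<eta> \<le> r"
      using \<delta> c r by (auto simp: \<eta>_def)
    obtain W0 where W0: "finite W0" "W0 \<subseteq> carrier G"
      "\<forall>u\<in>X. \<forall>v\<in>X. (\<forall>w\<in>W0. dist (act w u) (act w v) \<le> c) \<longrightarrow> dist u v < \<eta>"
      using uniformly_expansive[OF c(2) \<eta>(1)] by (elim exE conjE) (rule that)
    define W where "W = insert \<one> W0"
    obtain F0 where F0: "finite F0" "F0 \<subseteq> carrier G"
      "\<forall>g\<in>carrier G - F0. dist (act g (x k)) (act g (x (k+1))) \<le> \<eta>"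
      using assms(6) \<eta>(1) unfolding asymptotic_pair_def by metis
    \<comment> \<open>With \<open>\<one>\<close> in \<open>A\<close> it is also in \<open>B\<close>,
      so that closeness on \<open>B\<close> includes the visiting time itself.\<close>
    define A where "A = insert \<one> F0"
    have W: "finite W" "W \<subseteq> carrier G" "\<one> \<in> W" using W0 by (auto simp: W_def)
    have A: "finite A" "A \<subseteq> carrier G" "\<one> \<in> A" using F0 by (auto simp: A_def)
    obtain B0 where B0: "memory_set G X act \<epsilon> \<delta> A B0" using memory A by blast
    \<comment> \<open>The set W W^{-1} A is added to the memory set: if \<open>w \<otimes> g\<close>
      is in \<open>A\<close>, then \<open>g\<close> is in W^{-1} A, and the whole window around
      \<open>g\<close> lies in \<open>B\<close>.\<close>
    define B where "B = B0 \<union> (\<lambda>(w', w, a). w' \<otimes> (inv w \<otimes> a)) ` (W \<times> W \<times> A)"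
    have B: "finite B" "B \<subseteq> carrier G" "A \<subseteq> B" "\<one> \<in> B"
      using B0 W A by (auto simp: B_def memory_set_def)
    have window: "w' \<otimes> g \<in> B" if "g \<in> carrier G" "w \<in> W" "w' \<in> W" "w \<otimes> g \<in> A" for g w w'
    proof -
      have "w \<in> carrier G" using that W by auto
      then have "g = inv w \<otimes> (w \<otimes> g)" using that by (simp add: m_assoc[symmetric])
      then show ?thesis using that unfolding B_def by force
    qed
    txt \<open>A memory set may be enlarged at the price of replacing \<open>\<epsilon>\<close> by \<open>\<epsilon> + 5 * \<eta>\<close>.\<close>
    have replace: "\<exists>z\<in>X. (\<forall>h\<in>B. dist (act h u) (act h z) \<le> \<epsilon> + 5 * \<eta>) \<and>
        (\<forall>h\<in>carrier G - A. dist (act h v) (act h z) \<le> \<epsilon> + 5 * \<eta>)"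
      if uv: "u \<in> X" "v \<in> X" and *: "\<And>h. h \<in> B - A \<Longrightarrow> dist (act h u) (act h v) \<le> 5 * \<eta>" for u v
    proof -
      have "\<exists>z\<in>X. (\<forall>h\<in>B0. dist (act h u) (act h z) \<le> \<epsilon>) \<and>
          (\<forall>h\<in>carrier G - A. dist (act h v) (act h z) \<le> \<epsilon>)"
      proof (rule memory_set_pointwise[OF B0 _ _ uv])
        show "dist (act h u) (act h v) \<le> \<delta>" if "h \<in> B0 - A" for h
          using *[of h] that \<eta>(2) by (auto simp: B_def)
      qed (use c(1) \<delta> in \<open>auto simp: \<epsilon>_def\<close>)
      then obtain z where z: "z \<in> X" "\<And>h. h \<in> B0 \<Longrightarrow> dist (act h u) (act h z) \<le> \<epsilon>"
        "\<And>h. h \<in> carrier G - A \<Longrightarrow> dist (act h v) (act h z) \<le> \<epsilon>"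
        by blast
      have "dist (act h u) (act h z) \<le> \<epsilon> + 5 * \<eta>" if h: "h \<in> B" for h
      proof (cases "h \<in> B0")
        case True
        then show ?thesis using z(2)[OF True] \<eta>(1) by linarith
      next
        case False
        then have "h \<notin> A" "h \<in> carrier G" using B0 h B by (auto simp: memory_set_def)
        then show ?thesis
          using z(3)[of h] *[of h] h dist_triangle[of "act h u" "act h z" "act h v"] by auto
      qed
      moreover have "dist (act h v) (act h z) \<le> \<epsilon> + 5 * \<eta>" if "h \<in> carrier G - A" for h
        using z(3)[OF that] \<eta>(1) by linarith
      ultimately show ?thesis using z(1) by blast
    qed
    \<comment> \<open>Closeness on all of \<open>B\<close>, not only at \<open>\<one>\<close>, makes
      \<open>y\<close> follow \<open>x k\<close> long enough for a replacement.\<close>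
    define V where "V i = {u \<in> X. \<forall>h\<in>B. dist (act h u) (act h (x i)) < \<eta>}" for i
    have "independence_density G act k V > 0"
    proof -
      have "restrict x {1..k} i \<in> top_of_set X interior_of V i" if "i \<in> {1..k}" for i
        using neighborhood_in_interior[OF xX B(1,2) \<eta>(1), of i] that by (simp add: V_def)
      moreover have "V i \<subseteq> X" for i by (auto simp: V_def)
      ultimately show ?thesis using assms(5) by (simp add: IE_def)
    qed
    then obtain q where q: "q > 0" "independence_density_bound G act k V q"
      using independence_density_pos_iff[OF ne] by blast
    \<comment> \<open>The factor lost in passing to a subset with disjoint translates of
      \<open>B\<close>.\<close>
    define N where "N = real ((card B)\<^sup>2)"
    have N: "N > 0" using B by (auto simp: N_def card_gt_0_iff)
    have "independence_density_bound G act (k+1) U (q / N)"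
      unfolding independence_density_bound_def
    proof (intro conjI allI impI)
      show "q / N \<ge> 0" using q N by simp
    next
      fix F assume F: "finite F \<and> F \<subseteq> carrier G"
      then obtain J where J: "J \<subseteq> F" "real (card J) \<ge> q * real (card F)" "independence_set G act k V J"
        using q unfolding independence_density_bound_def by blast
      have "finite J" "J \<subseteq> carrier G" "B \<noteq> {}" using J(1) F B(4) finite_subset by auto
      then obtain J' where J': "J' \<subseteq> J" "card J \<le> card J' * (card B)\<^sup>2"
        and sep: "\<And>s t g h. s \<in> J' \<Longrightarrow> t \<in> J' \<Longrightarrow> s \<noteq> t \<Longrightarrow> g \<in> B \<Longrightarrow> h \<in> B \<Longrightarrow> g \<otimes> s \<noteq> h \<otimes> t"
        using separated_subset[OF _ _ B(1,2)] by metis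
      have "q * real (card F) \<le> real (card J') * N"
        using J(2) J'(2) unfolding N_def by (metis of_nat_le_iff of_nat_mult order_trans)
      then have "q / N * real (card F) \<le> real (card J')"
        using N by (simp add: field_simps)
      moreover have "independence_set G act (k+1) U J'"
        unfolding independence_set_def
      proof (intro conjI allI impI ballI)
        show "J' \<subseteq> carrier G" using J' J F by blast
      next
        fix I \<phi> assume I: "finite I \<and> I \<noteq> {} \<and> I \<subseteq> J'" and \<phi>: "\<phi> \<in> I \<rightarrow> {1..k+1}"
        have IG: "I \<subseteq> carrier G" using I J' J F by blast
        \<comment> \<open>The label \<open>k + 1\<close> is lowered to \<open>k\<close>, so that
          independence for \<open>V\<close> applies; the set \<open>S\<close> below records the
          times to be corrected.\<close>
        define \<psi> where "\<psi> s = min (\<phi> s) k" for s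
        have \<psi>: "\<psi> \<in> I \<rightarrow> {1..k}" using \<phi> assms(3) by (auto simp: \<psi>_def Pi_iff)
        have "finite I \<and> I \<noteq> {} \<and> I \<subseteq> J" using I J'(1) by auto
        then have "(\<Inter>s\<in>I. act (inv s) ` V (\<psi> s)) \<noteq> {}"
          by (rule J(3)[unfolded independence_set_def, THEN conjunct2, THEN spec, THEN mp, THEN bspec, OF _ \<psi>])
        then obtain y where y: "\<And>s. s \<in> I \<Longrightarrow> y \<in> act (inv s) ` V (\<psi> s)" by blast
        have yV: "y \<in> X \<and> act s y \<in> V (\<psi> s)" if "s \<in> I" for s
          using y[OF that] mem_act_inv_image_iff[of s "V (\<psi> s)" y] that IG by (auto simp: V_def)
        have yX: "y \<in> X" using yV I by blast
        define S where "S = {s \<in> I. \<phi> s = k + 1}"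
        have "\<exists>z\<in>X. (\<forall>g\<in>carrier G. (\<forall>s\<in>S. \<forall>a\<in>A. g \<noteq> a \<otimes> s) \<longrightarrow> dist (act g z) (act g y) \<le> 3 * \<eta>) \<and>
               (\<forall>s\<in>S. \<forall>h\<in>B. dist (act (h \<otimes> s) z) (act h (x (k+1))) \<le> 3 * \<eta>)"
        \<comment> \<open>The tolerances 5\<eta> and \<epsilon> + 5\<eta> are those that
          \<open>replace\<close> gives for the enlarged \<open>B\<close>.\<close>
        proof (rule simultaneous_replacement[where p = "x k" and W = W and c = c
                and \<delta> = "5 * \<eta>" and \<epsilon> = "\<epsilon> + 5 * \<eta>"])
          show "g \<otimes> s \<noteq> h \<otimes> t" if "s \<in> S" "t \<in> S" "s \<noteq> t" "g \<in> B" "h \<in> B" for s t g h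
            using that I by (intro sep) (auto simp: S_def)
          show "dist (act (h \<otimes> s) y) (act h (x k)) \<le> \<eta>" if "s \<in> S" "h \<in> B" for s h
          proof -
            have *: "s \<in> I" "\<psi> s = k" "s \<in> carrier G" "h \<in> carrier G"
              using that IG B by (auto simp: S_def \<psi>_def)
            then show ?thesis using yV[of s] that yX by (auto simp: V_def act_mult less_imp_le)
          qed
          show "dist u v \<le> \<eta>" if "u \<in> X" "v \<in> X" "\<And>w. w \<in> W \<Longrightarrow> dist (act w u) (act w v) \<le> c" for u v
            using W0(3) that by (force simp: W_def)
          show "\<epsilon> + 5 * \<eta> + 3 * \<eta> \<le> c" using \<eta> c by (simp add: \<epsilon>_def)
          show "finite S" "S \<subseteq> carrier G" using I IG by (auto simp: S_def)
          show "x k \<in> X" "x (k+1) \<in> X" using xX assms(3) by auto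
          show "dist (act h (x k)) (act h (x (k+1))) \<le> \<eta>" if "h \<in> carrier G - A" for h
            using F0(3) that by (simp add: A_def)
          show "w' \<otimes> g \<in> B" if "g \<in> carrier G" "w \<in> W" "w' \<in> W" "w \<otimes> g \<in> A" for g w w'
            using that by (rule window)
          show "\<exists>z\<in>X. (\<forall>h\<in>B. dist (act h u) (act h z) \<le> \<epsilon> + 5 * \<eta>) \<and>
              (\<forall>h\<in>carrier G - A. dist (act h v) (act h z) \<le> \<epsilon> + 5 * \<eta>)"
            if "u \<in> X" "v \<in> X" "\<And>h. h \<in> B - A \<Longrightarrow> dist (act h u) (act h v) \<le> 5 * \<eta>" for u v
            using that by (rule replace)
        qed (simp_all add: B W yX \<eta>(1) less_imp_le)
        then obtain z where z: "z \<in> X"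
          and z_off: "\<And>g. g \<in> carrier G \<Longrightarrow> (\<And>s a. s \<in> S \<Longrightarrow> a \<in> A \<Longrightarrow> g \<noteq> a \<otimes> s) \<Longrightarrow> dist (act g z) (act g y) \<le> 3 * \<eta>"
          and z_on: "\<And>s h. s \<in> S \<Longrightarrow> h \<in> B \<Longrightarrow> dist (act (h \<otimes> s) z) (act h (x (k+1))) \<le> 3 * \<eta>"
          by blast
        have "z \<in> act (inv s) ` U (\<phi> s)" if s: "s \<in> I" for s
        proof -
          have sG: "s \<in> carrier G" using s IG by auto
          have \<phi>s: "\<phi> s \<in> {1..k+1}" using \<phi> s by auto
          have "dist (act s z) (x (\<phi> s)) < r"
          proof (cases "s \<in> S")
            case True
            then show ?thesis using z_on[OF True B(4)] sG \<eta> xX[of "k+1"] by (simp add: S_def act_one)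
          next
            case False
            \<comment> \<open>Separation with \<open>\<one>\<close> in \<open>B\<close> shows that
              \<open>s\<close> lies in no replaced translate of \<open>A\<close>, so
              \<open>z\<close> still follows \<open>y\<close> at time \<open>s\<close>.\<close>
            have "s \<noteq> a \<otimes> t" if "t \<in> S" "a \<in> A" for t a
            proof -
              have "s \<in> J'" "t \<in> J'" "s \<noteq> t" "a \<in> B" using that s I False B(3) by (auto simp: S_def)
              then have "\<one> \<otimes> s \<noteq> a \<otimes> t" using B(4) by (intro sep)
              then show ?thesis using sG by simp
            qed
            then have "dist (act s z) (act s y) \<le> 3 * \<eta>" using z_off[OF sG] by blast
            moreover have "\<psi> s = \<phi> s" using False s \<phi>s by (auto simp: S_def \<psi>_def)
            then have "dist (act \<one> (act s y)) (act \<one> (x (\<phi> s))) < \<eta>"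
              using yV[OF s] B by (auto simp: V_def)
            ultimately show ?thesis
              using \<eta> dist_triangle[of "act s z" "x (\<phi> s)" "act s y"] xX[OF \<phi>s] yX sG
              by (simp add: act_one act_closed)
          qed
          then have "act s z \<in> U (\<phi> s)"
            using ball_r[OF \<phi>s] act_closed[OF sG z] by (auto simp: dist_commute)
          then show ?thesis using mem_act_inv_image_iff[OF sG] U \<phi>s z by blast
        qed
        then show "(\<Inter>s\<in>I. act (inv s) ` U (\<phi> s)) \<noteq> {}" by blast
      qed
      ultimately show "\<exists>J\<subseteq>F. q / N * real (card F) \<le> real (card J) \<and> independence_set G act (k+1) U J"
        using J J' by blast
    qed
    then show ?thesis
      unfolding independence_density_pos_iff[OF ne]
      using divide_pos_pos[OF q(1) N] by (intro exI[of _ "q / N"] conjI)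
  qed
  then show ?thesis
    unfolding IE_def using assms(4) by (intro CollectI conjI allI impI)
qed

end

theorem theorem6p1:
  fixes G :: "('g, 'm) monoid_scheme"
    and X :: "'x::metric_space set"
    and act :: "'g \<Rightarrow> 'x \<Rightarrow> 'x"
    and k :: nat
    and x :: "nat \<Rightarrow> 'x"
  assumes "countable (carrier G)" and "infinite (carrier G)"
    and "compact X"
    and "group_action G X act"
    and "\<And>g. g \<in> carrier G \<Longrightarrow> homeomorphic_map (top_of_set X) (top_of_set X) (act g)"
    and "expansive G X act"
    and "topological_Markov_property G X act"
    and "k \<ge> 1"
    and "x \<in> {1..k+1} \<rightarrow>\<^sub>E X"
    and "restrict x {1..k} \<in> IE k G X act"
    and "asymptotic_pair G X act (x k) (x (k+1))"
  shows "x \<in> IE (k+1) G X act"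
proof -
  interpret compact_group_action G X act
    by (rule compact_group_action.intro[OF assms(4) compact_group_action_axioms.intro[OF assms(3,5)]])
  show ?thesis by (rule IE_extend_asymptotic[OF assms(6-11)])
qed

end
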